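(* Let three finite points $\hat{\mathbf x}_1,\hat{\mathbf x}_2,\hat{\mathbf x}_3$ and two lines $\mathbf l_1,\mathbf l_2$ of $\mathrm P\mathbb R^2$ be in general position, and consider the problem of determining a non-degenerate conic $\mathbf C$ (over $\mathbb C$) such that $\hat{\mathbf x}_i^T\mathbf C\hat{\mathbf x}_i=0$ for $i=1,2,3$ and $\mathbf l_j^T\mathbf C^{-1}\mathbf l_j=0$ for $j=1,2$. Suppose that some two of the three points and the intersection point of the two lines are collinear. Then: (i) when the remaining third point does not lie on any of the two lines, the problem has two distinct solutions; (ii) when the remaining third point lies on one of the two lines, the problem has a unique real solution.
   Context: $\mathrm P\mathbb R^2$ is the real projective plane. A hat denotes a finite point in normalized homogeneous coordinates, i.e. a vector of $\mathbb R^3$ whose third component is $1$. A line is given by a nonzero vector $\mathbf l\in\mathbb R^3$ (up to scale), and $\mathbf x$ lies on $\mathbf l$ iff $\mathbf x^T\mathbf l=0$; the two lines are distinct and the cross product $\mathbf l_1\times\mathbf l_2$ is their intersection point. A side of a triangle is the full line through two of its vertices. Three points and two lines are in general position if the three points are non-collinear, neither $\mathbf l_1$ nor $\mathbf l_2$ is a side of the triangle $\hat{\mathbf x}_1\hat{\mathbf x}_2\hat{\mathbf x}_3$, and the intersection point of $\mathbf l_1$ and $\mathbf l_2$ is not a vertex of that triangle. A conic is a nonzero complex symmetric $3\times3$ matrix up to nonzero scale; it is non-degenerate if its determinant is nonzero and real if it can be represented by a real matrix. Solutions are counted up to scale. "Unique real solution" means that there is exactly one real non-degenerate conic (up to scale)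 satisfying the conditions. *)

theory Defs
  imports "HOL-Analysis.Analysis"
begin

text \<open>
  Points and lines of the real projective plane are represented by nonzero vectors in
  \<open>real^3\<close>, up to nonzero scale.
\<close>

definition proj_eq :: "real^3 \<Rightarrow> real^3 \<Rightarrow> bool" where
  "proj_eq u v \<longleftrightarrow> (\<exists>c. c \<noteq> 0 \<and> v = c *\<^sub>R u)"

definition lies_on :: "real^3 \<Rightarrow> real^3 \<Rightarrow> bool" where
  "lies_on x l \<longleftrightarrow> x \<bullet> l = 0"

definition proj_collinear :: "(real^3) set \<Rightarrow> bool" where
  "proj_collinear S \<longleftrightarrow> (\<exists>l. l \<noteq> 0 \<and> (\<forall>x\<in>S. lies_on x l))"

definition finite_point :: "real^3 \<Rightarrow> bool" where
  "finite_point x \<longleftrightarrow> x $ 3 = 1"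

definition triangle_side :: "(3 \<Rightarrow> real^3) \<Rightarrow> real^3 \<Rightarrow> bool" where
  "triangle_side x l \<longleftrightarrow> (\<exists>i j. i \<noteq> j \<and> lies_on (x i) l \<and> lies_on (x j) l)"

definition general_position :: "(3 \<Rightarrow> real^3) \<Rightarrow> real^3 \<Rightarrow> real^3 \<Rightarrow> bool" where
  "general_position x l1 l2 \<longleftrightarrow>
     \<not> proj_collinear (range x) \<and>
     \<not> triangle_side x l1 \<and> \<not> triangle_side x l2 \<and>
     (\<forall>i. \<not> proj_eq (cross3 l1 l2) (x i))"

definition is_conic :: "complex^3^3 \<Rightarrow> bool" where
  "is_conic C \<longleftrightarrow> C \<noteq> 0 \<and> Finite_Cartesian_Product.transpose C = C"

definition nondegenerate_conic :: "complex^3^3 \<Rightarrow> bool" where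
  "nondegenerate_conic C \<longleftrightarrow> is_conic C \<and> det C \<noteq> 0"

definition conic_scale :: "((complex^3^3) \<times> (complex^3^3)) set" where
  "conic_scale =
     {(C, D). is_conic C \<and> is_conic D \<and> (\<exists>c. c \<noteq> 0 \<and> D = map_matrix ((*) c) C)}"

lemma equiv_conic_scale: "equiv {C. is_conic C} conic_scale"
proof (rule equivI)
  show "conic_scale \<subseteq> {C. is_conic C} \<times> {C. is_conic C}"
    by (auto simp: conic_scale_def)
  show "refl_on {C. is_conic C} conic_scale"
    by (auto simp: refl_on_def conic_scale_def vec_eq_iff intro!: exI[of _ 1])
  show "sym conic_scale"
  proof (rule symI)
    fix C D assume "(C, D) \<in> conic_scale"
    then obtain c where h: "is_conic C" "is_conic D" "c \<noteq> 0" and D: "D = map_matrix ((*) c) C"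
      unfolding conic_scale_def by blast
    have "C = map_matrix ((*) (inverse c)) D"
      unfolding D using h(3) by (simp add: vec_eq_iff)
    moreover have "inverse c \<noteq> 0"
      using h(3) by simp
    ultimately show "(D, C) \<in> conic_scale"
      unfolding conic_scale_def using h(1,2) by blast
  qed
  show "trans conic_scale"
  proof (rule transI)
    fix C D E assume "(C, D) \<in> conic_scale" "(D, E) \<in> conic_scale"
    then obtain c d where h: "is_conic C" "is_conic E" "c \<noteq> 0" "d \<noteq> 0"
        and D: "D = map_matrix ((*) c) C" and E: "E = map_matrix ((*) d) D"
      unfolding conic_scale_def by blast
    have "E = map_matrix ((*) (d * c)) C"
      unfolding E D by (simp add: vec_eq_iff mult.assoc)
    moreover have "d * c \<noteq> 0"
      using h(3,4) by simp
    ultimately show "(C, E) \<in> conic_scale"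
      unfolding conic_scale_def using h(1,2) by blast
  qed
qed

definition real_conic :: "complex^3^3 \<Rightarrow> bool" where
  "real_conic C \<longleftrightarrow> (\<exists>R :: real^3^3. (C, map_matrix complex_of_real R) \<in> conic_scale)"

definition complex_vec :: "real^3 \<Rightarrow> complex^3" where
  "complex_vec v = (\<chi> i. complex_of_real (v $ i))"

text \<open>
  The bilinear expression \<open>v\<^sup>T A v\<close>; the library's inner product on \<open>complex^3\<close> is real-valued
  and would not do.
\<close>

definition qform :: "complex^3^3 \<Rightarrow> complex^3 \<Rightarrow> complex" where
  "qform A v = (\<Sum>i\<in>UNIV. v $ i * (A *v v) $ i)"

definition solutions :: "(3 \<Rightarrow> real^3) \<Rightarrow> real^3 \<Rightarrow> real^3 \<Rightarrow> (complex^3^3) set" where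
  "solutions x l1 l2 =
     {C. nondegenerate_conic C \<and>
         (\<forall>i. qform C (complex_vec (x i)) = 0) \<and>
         qform (matrix_inv C) (complex_vec l1) = 0 \<and>
         qform (matrix_inv C) (complex_vec l2) = 0}"

end

theory Submission
  imports Defs
begin

text \<open>
  Take the three points as the vertices of the coordinate triangle, the two points collinear
  with \<open>l1 \<times> l2\<close> first. A conic through the vertices is a symmetric matrix with zero diagonal,
  hence given by three off-diagonal entries \<open>a, b, c\<close>, and its determinant is \<open>2 a b c\<close>. A
  line has as coordinates its products with the three points. The collinearity hypothesis
  says that the first two coordinates of the two lines are proportional
  (\<open>collinear_intersection_imp_proportional\<close>), and general position makes these four
  numbers nonzero, so after rescaling the lines are \<open>(p, q, r)\<close> and \<open>(p, q, s)\<close> with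
  \<open>p, q \<noteq> 0\<close> and \<open>r \<noteq> s\<close>.

  The difference of the two quadratic tangency conditions is then linear up to the nonzero
  factor \<open>a (r - s)\<close>: it gives \<open>2 (c p + b q) = a (r + s)\<close>, and the other condition becomes
  \<open>(c p - b q)\<^sup>2 = a\<^sup>2 r s\<close> (\<open>tangency_pencil_iff\<close>). So the solutions up to scale correspond
  to the complex square roots \<open>w\<close> of \<open>r s\<close>, and each of them is non-degenerate because
  \<open>((r + s) / 2 - w) ((r + s) / 2 + w) = ((r - s) / 2)\<^sup>2 \<noteq> 0\<close> (\<open>half_sum_pm_root_nonzero\<close>).
  Undoing the change of coordinates (\<open>solutions_eq_pencil\<close>) keeps this count.

  The third point lies on one of the lines iff \<open>r = 0\<close> or \<open>s = 0\<close>. If it lies on neither,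
  \<open>r s\<close> has two square roots and there are two solutions. If it lies on one of them, \<open>w = 0\<close>
  is the only root and the single solution has real entries.
\<close>

unbundle cross3_syntax

section \<open>Matrices and the action of congruences\<close>

lemma map_matrix_times_congruence:
  fixes A C B :: "'a::comm_semiring_1^'n^'n"
  shows "A ** map_matrix ((*) u) C ** B = map_matrix ((*) u) (A ** C ** B)"
  by (simp add: vec_eq_iff matrix_matrix_mult_def sum_distrib_left sum_distrib_right mult_ac)

lemma map_matrix_of_real_mult:
  fixes A B :: "real^'n^'n"
  shows "map_matrix complex_of_real (A ** B) = map_matrix complex_of_real A ** map_matrix complex_of_real B"
  by (simp add: vec_eq_iff matrix_matrix_mult_def)

text \<open>
  The inverse is defined by a choice operator; one one-sided inverse of a square matrix
  already pins it down.
\<close>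
lemma matrix_inv_eqI:
  fixes A B :: "'a::field^'n^'n"
  assumes "A ** B = mat 1"
  shows "matrix_inv A = B"
proof -
  have "B ** A = mat 1"
    using assms matrix_left_right_inverse by blast
  then have "\<exists>A'. A ** A' = mat 1 \<and> A' ** A = mat 1"
    using assms by blast
  then have "matrix_inv A ** A = mat 1"
    unfolding matrix_inv_def by (rule someI2_ex) simp
  then show ?thesis
    by (metis assms matrix_mul_assoc matrix_mul_lid matrix_mul_rid)
qed

text \<open>
  Point conditions transform by \<open>C \<mapsto> X C X\<^sup>T\<close>. This is the matching rule for the dual
  conic; it lets the tangency conditions be read off in the new coordinates.
\<close>
lemma matrix_inv_congruence:
  fixes X C :: "'a::field^'n^'n"
  assumes "det X \<noteq> 0" "det C \<noteq> 0"
  shows "matrix_inv C = Finite_Cartesian_Product.transpose X **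
    matrix_inv (X ** C ** Finite_Cartesian_Product.transpose X) ** X"
proof -
  obtain Y where Y: "X ** Y = mat 1" "Y ** X = mat 1"
    using assms(1) by (auto simp: invertible_def simp flip: invertible_det_nz)
  obtain N where N: "C ** N = mat 1"
    using assms(2) by (auto simp: invertible_def simp flip: invertible_det_nz)
  let ?T = "Finite_Cartesian_Product.transpose :: 'a^'n^'n \<Rightarrow> 'a^'n^'n"
  have T: "?T X ** ?T Y = mat 1"
    by (metis Y(2) matrix_transpose_mul transpose_mat)
  have "(X ** C ** ?T X) ** (?T Y ** N ** Y) = X ** C ** (?T X ** ?T Y) ** N ** Y"
    by (simp add: matrix_mul_assoc)
  also have "\<dots> = X ** (C ** N) ** Y"
    by (simp add: T flip: matrix_mul_assoc)
  also have "\<dots> = mat 1"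
    by (simp add: N Y)
  finally have "matrix_inv (X ** C ** ?T X) = ?T Y ** N ** Y"
    by (rule matrix_inv_eqI)
  then have "?T X ** matrix_inv (X ** C ** ?T X) ** X = (?T X ** ?T Y) ** N ** (Y ** X)"
    by (simp add: matrix_mul_assoc)
  then show ?thesis
    by (simp add: T Y matrix_inv_eqI[OF N])
qed

lemma qform_congruence:
  "qform (A ** C ** Finite_Cartesian_Product.transpose A) v =
   qform C (Finite_Cartesian_Product.transpose A *v v)"
proof -
  have adj: "(\<Sum>m\<in>UNIV. v $ m * (A *v w) $ m) =
      (\<Sum>m\<in>UNIV. (Finite_Cartesian_Product.transpose A *v v) $ m * w $ m)" for w
    by (simp add: matrix_vector_mult_def sum_3 Finite_Cartesian_Product.transpose_def algebra_simps)
  show ?thesis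
    unfolding qform_def
    by (simp add: adj flip: matrix_vector_mul_assoc)
qed

lemma congruence_diagonal:
  "(X ** C ** Finite_Cartesian_Product.transpose X) $ m $ m = qform C (X $ m)"
  by (simp add: qform_def matrix_matrix_mult_def matrix_vector_mult_def
      Finite_Cartesian_Product.transpose_def sum_3 algebra_simps)

section \<open>Conics through the vertices of a triangle\<close>

text \<open>
  The conics through the three vertices of the coordinate triangle.
\<close>
definition triangle_conic :: "complex \<Rightarrow> complex \<Rightarrow> complex \<Rightarrow> complex^3^3" where
  "triangle_conic a b c =
     vector [vector [0, a, b], vector [a, 0, c], vector [b, c, 0]]"

lemma triangle_conic_iff:
  "Finite_Cartesian_Product.transpose M = M \<and> M$1$1 = 0 \<and> M$2$2 = 0 \<and> M$3$3 = 0
     \<longleftrightarrow> M = triangle_conic (M$1$2) (M$1$3) (M$2$3)"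
  by (auto simp: triangle_conic_def vec_eq_iff forall_3 Finite_Cartesian_Product.transpose_def)

lemma transpose_triangle_conic:
  "Finite_Cartesian_Product.transpose (triangle_conic a b c) = triangle_conic a b c"
  by (auto simp: triangle_conic_def vec_eq_iff forall_3 Finite_Cartesian_Product.transpose_def)

lemma det_triangle_conic: "det (triangle_conic a b c) = 2 * a * b * c"
  by (simp add: triangle_conic_def det_3)

lemma scale_triangle_conic:
  "map_matrix ((*) u) (triangle_conic a b c) = triangle_conic (u * a) (u * b) (u * c)"
  by (simp add: triangle_conic_def vec_eq_iff forall_3)

text \<open>
  Up to the factor \<open>- 1 / det\<close>, the dual form of \<open>triangle_conic a b c\<close> at the line
  \<open>(p, q, r)\<close>. Its zero set is \<open>\<plusminus>sqrt (c p) \<plusminus> sqrt (b q) \<plusminus> sqrt (a r) = 0\<close> with the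
  radicals cleared.
\<close>
definition tangency :: "complex \<Rightarrow> complex \<Rightarrow> complex \<Rightarrow> complex \<Rightarrow> complex \<Rightarrow> complex \<Rightarrow> complex" where
  "tangency a b c p q r =
     (c*p)^2 + (b*q)^2 + (a*r)^2 - 2*(c*p)*(b*q) - 2*(c*p)*(a*r) - 2*(b*q)*(a*r)"

lemma qform_inverse_triangle_conic:
  assumes "a \<noteq> 0" "b \<noteq> 0" "c \<noteq> 0"
  shows "qform (matrix_inv (triangle_conic a b c)) v = 0 \<longleftrightarrow> tangency a b c (v$1) (v$2) (v$3) = 0"
proof -
  define d where "d = - 1 / (2 * a * b * c)"
  \<comment> \<open>\<open>N\<close> is the adjugate of the conic divided by its determinant.\<close>
  define N :: "complex^3^3" where
    "N = map_matrix ((*) d) (vector [vector [c*c, -(b*c), -(a*c)],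
       vector [-(b*c), b*b, -(a*b)], vector [-(a*c), -(a*b), a*a]])"
  have "d \<noteq> 0" using assms by (simp add: d_def)
  have "triangle_conic a b c ** N = mat 1"
    using assms
    by (simp add: triangle_conic_def N_def vec_eq_iff forall_3 matrix_matrix_mult_def sum_3 mat_def d_def
        field_simps)
  then have "matrix_inv (triangle_conic a b c) = N"
    by (rule matrix_inv_eqI)
  moreover have "qform N v = d * tangency a b c (v$1) (v$2) (v$3)"
    by (simp add: qform_def N_def tangency_def matrix_vector_mult_def sum_3 power2_eq_square algebra_simps)
  ultimately show ?thesis
    using \<open>d \<noteq> 0\<close> by simp
qed

section \<open>Tangency to two lines meeting on a side of the triangle\<close>

text \<open>
  Put \<open>C = c p\<close> and \<open>B = b q\<close>. Tangency to \<open>(p, q, z)\<close> reads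
  \<open>(C - B)\<^sup>2 = a z (2 (C + B) - a z)\<close>. Since the two lines agree in their first two
  coordinates, the difference of the conditions for \<open>z = r\<close> and \<open>z = s\<close> is divisible by
  \<open>a (r - s)\<close> and leaves the linear condition \<open>2 (C + B) = a (r + s)\<close>. What remains is
  \<open>(C - B)\<^sup>2 = a\<^sup>2 r s\<close>, so a square root \<open>w\<close> of \<open>r s\<close> is the only freedom.
\<close>
lemma tangency_pencil_iff:
  assumes "p \<noteq> 0" "q \<noteq> 0" "t \<noteq> 0" "a \<noteq> 0" "r \<noteq> s"
  shows "tangency a b c p q r = 0 \<and> tangency a b c (t * p) (t * q) (t * s) = 0 \<longleftrightarrow>
         (\<exists>w. w^2 = r * s \<and> b = a * (((r + s) / 2 - w) / (2 * q)) \<and>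
              c = a * (((r + s) / 2 + w) / (2 * p)))"
    (is "?L \<longleftrightarrow> ?R")
proof -
  define B C where "B = b * q" and "C = c * p"
  have hom: "tangency a b c (t * p) (t * q) (t * s) = t^2 * tangency a b c p q s"
    by (simp add: tangency_def power2_eq_square algebra_simps)
  have form: "tangency a b c p q z = (C - B)^2 - a * z * (2 * (C + B) - a * z)" for z
    by (simp add: tangency_def B_def C_def power2_eq_square algebra_simps)
  have "?L \<longleftrightarrow> tangency a b c p q r = 0 \<and> tangency a b c p q s = 0"
    using assms by (simp add: hom)
  also have "\<dots> \<longleftrightarrow> 2 * (C + B) = a * (r + s) \<and> (C - B)^2 = a^2 * (r * s)"
  proof
    assume h: "tangency a b c p q r = 0 \<and> tangency a b c p q s = 0"
    have "a * (r - s) * (a * (r + s) - 2 * (C + B)) =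
        tangency a b c p q r - tangency a b c p q s"
      unfolding form by (simp add: power2_eq_square algebra_simps)
    then have sum: "2 * (C + B) = a * (r + s)"
      using h assms by simp
    have "(C - B)^2 = a * r * (2 * (C + B) - a * r)"
      using h unfolding form by simp
    then show "2 * (C + B) = a * (r + s) \<and> (C - B)^2 = a^2 * (r * s)"
      unfolding sum by (simp add: power2_eq_square algebra_simps)
  next
    assume h: "2 * (C + B) = a * (r + s) \<and> (C - B)^2 = a^2 * (r * s)"
    show "tangency a b c p q r = 0 \<and> tangency a b c p q s = 0"
      unfolding form h[THEN conjunct1] h[THEN conjunct2] by (simp add: power2_eq_square algebra_simps)
  qed
  also have "\<dots> \<longleftrightarrow> (\<exists>w. w^2 = r * s \<and> 2 * (C + B) = a * (r + s) \<and> C - B = a * w)"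
  proof
    assume h: "2 * (C + B) = a * (r + s) \<and> (C - B)^2 = a^2 * (r * s)"
    have "((C - B) / a)^2 = r * s"
      using h assms by (simp add: power_divide)
    then show "\<exists>w. w^2 = r * s \<and> 2 * (C + B) = a * (r + s) \<and> C - B = a * w"
      using h assms by (intro exI[of _ "(C - B) / a"]) simp
  qed (auto simp: power_mult_distrib)
  also have "\<dots> \<longleftrightarrow> ?R"
  proof -
    have "2 * (C + B) = a * (r + s) \<and> C - B = a * w \<longleftrightarrow>
        B = a * (((r + s) / 2 - w) / 2) \<and> C = a * (((r + s) / 2 + w) / 2)" for w
    proof
      assume h: "2 * (C + B) = a * (r + s) \<and> C - B = a * w"
      have "4 * B = 2 * (C + B) - 2 * (C - B)" by simp
      also have "\<dots> = a * (r + s) - 2 * (a * w)" using h by (simp only:)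
      finally have B4: "4 * B = a * (r + s) - 2 * (a * w)" .
      have "4 * C = 2 * (C + B) + 2 * (C - B)" by simp
      also have "\<dots> = a * (r + s) + 2 * (a * w)" using h by (simp only:)
      finally have "4 * C = a * (r + s) + 2 * (a * w)" .
      with B4 show "B = a * (((r + s) / 2 - w) / 2) \<and> C = a * (((r + s) / 2 + w) / 2)"
        by (simp add: field_simps)
    next
      assume h: "B = a * (((r + s) / 2 - w) / 2) \<and> C = a * (((r + s) / 2 + w) / 2)"
      show "2 * (C + B) = a * (r + s) \<and> C - B = a * w"
        unfolding h[THEN conjunct1] h[THEN conjunct2] by (simp add: field_simps)
    qed
    moreover have "B = a * (((r + s) / 2 - w) / 2) \<longleftrightarrow> b = a * (((r + s) / 2 - w) / (2 * q))" for w
      using assms by (simp add: B_def field_simps)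
    moreover have "C = a * (((r + s) / 2 + w) / 2) \<longleftrightarrow> c = a * (((r + s) / 2 + w) / (2 * p))" for w
      using assms by (simp add: C_def field_simps)
    ultimately show ?thesis by simp
  qed
  finally show ?thesis .
qed

text \<open>
  The product of the two numbers is \<open>((r - s) / 2)\<^sup>2\<close>. This is why none of the conics found
  from the quadratic equation degenerates.
\<close>
lemma half_sum_pm_root_nonzero:
  fixes r s w :: complex
  assumes "r \<noteq> s" "w^2 = r * s"
  shows "(r + s) / 2 - w \<noteq> 0" "(r + s) / 2 + w \<noteq> 0"
proof -
  have "((r + s) / 2 - w) * ((r + s) / 2 + w) = ((r - s) / 2)^2"
    using assms(2) by (simp add: power2_eq_square field_simps)
  also have "\<dots> \<noteq> 0" using assms(1) by simp
  finally show "(r + s) / 2 - w \<noteq> 0" "(r + s) / 2 + w \<noteq> 0" by auto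
qed

text \<open>
  The solution belonging to the square root \<open>w\<close> of \<open>r s\<close>, in triangle coordinates and
  normalized so that the entry coupling the first two vertices is 1.
\<close>
definition pencil_conic ::
    "complex \<Rightarrow> complex \<Rightarrow> complex \<Rightarrow> complex \<Rightarrow> complex \<Rightarrow> complex^3^3" where
  "pencil_conic p q r s w =
     triangle_conic 1 (((r + s) / 2 - w) / (2 * q)) (((r + s) / 2 + w) / (2 * p))"

text \<open>
  A triangle conic has determinant \<open>2 a b c\<close>, so non-degeneracy makes \<open>a\<close> nonzero and
  the normalization in \<open>pencil_conic\<close> possible.
\<close>
lemma tangent_triangle_conics:
  assumes "p \<noteq> 0" "q \<noteq> 0" "t \<noteq> 0" "r \<noteq> s"
  shows "Finite_Cartesian_Product.transpose M = M \<and> (\<forall>m. M$m$m = 0) \<and> det M \<noteq> 0 \<and>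
      qform (matrix_inv M) (vector [p, q, r]) = 0 \<and>
      qform (matrix_inv M) (vector [t * p, t * q, t * s]) = 0 \<longleftrightarrow>
    (\<exists>u w. u \<noteq> 0 \<and> w^2 = r * s \<and> M = map_matrix ((*) u) (pencil_conic p q r s w))"
    (is "?L \<longleftrightarrow> ?R")
proof
  assume L: ?L
  define a b c where "a = M$1$2" and "b = M$1$3" and "c = M$2$3"
  have M: "M = triangle_conic a b c"
    using L triangle_conic_iff[of M] by (simp add: a_def b_def c_def)
  have nz: "a \<noteq> 0" "b \<noteq> 0" "c \<noteq> 0"
    using L by (auto simp: M det_triangle_conic)
  have "tangency a b c p q r = 0 \<and> tangency a b c (t * p) (t * q) (t * s) = 0"
    using L nz by (simp add: M qform_inverse_triangle_conic)
  then obtain w where w: "w^2 = r * s" and "b = a * (((r + s) / 2 - w) / (2 * q))"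
      "c = a * (((r + s) / 2 + w) / (2 * p))"
    using tangency_pencil_iff[OF assms(1-3) nz(1) assms(4)] by blast
  then have "M = map_matrix ((*) a) (pencil_conic p q r s w)"
    by (simp add: M pencil_conic_def scale_triangle_conic)
  then show ?R
    using nz w by blast
next
  assume ?R
  then obtain a w where nz: "a \<noteq> 0" and w: "w^2 = r * s"
    and M0: "M = map_matrix ((*) a) (pencil_conic p q r s w)" by blast
  define b c where "b = a * (((r + s) / 2 - w) / (2 * q))" and "c = a * (((r + s) / 2 + w) / (2 * p))"
  have M: "M = triangle_conic a b c"
    by (simp add: M0 pencil_conic_def scale_triangle_conic b_def c_def)
  have nz': "b \<noteq> 0" "c \<noteq> 0"
    using half_sum_pm_root_nonzero[OF assms(4) w] assms nz by (simp_all add: b_def c_def)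
  have "tangency a b c p q r = 0 \<and> tangency a b c (t * p) (t * q) (t * s) = 0"
    using tangency_pencil_iff[OF assms(1-3) nz assms(4)] w b_def c_def by blast
  then have "qform (matrix_inv M) (vector [p, q, r]) = 0 \<and>
      qform (matrix_inv M) (vector [t * p, t * q, t * s]) = 0"
    using nz nz' by (simp add: M qform_inverse_triangle_conic)
  moreover have "\<forall>m. M$m$m = 0"
    by (simp add: M triangle_conic_def forall_3)
  ultimately show ?L
    using nz nz' by (simp add: M transpose_triangle_conic det_triangle_conic)
qed

section \<open>Counting conics up to scale\<close>

text \<open>
  The solution set is closed under rescaling, so it is the saturation of a family of
  representatives, and counting it up to scale amounts to counting the parameters.
\<close>
lemma card_quotient_conic_scale:
  assumes "\<And>w. w \<in> W \<Longrightarrow> is_conic (D w)"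
    and "\<And>w w'. w \<in> W \<Longrightarrow> w' \<in> W \<Longrightarrow> (D w, D w') \<in> conic_scale \<Longrightarrow> w = w'"
  shows "card ((conic_scale `` (D ` W)) // conic_scale) = card W"
proof -
  have cls: "conic_scale `` {C} = conic_scale `` {D w}"
    if "(D w, C) \<in> conic_scale" for w C
    using equiv_class_eq[OF equiv_conic_scale that] by simp
  have refl: "(D w, D w) \<in> conic_scale" if "w \<in> W" for w
    using equiv_conic_scale assms(1)[OF that] by (simp add: equiv_def refl_on_def)
  have "(conic_scale `` (D ` W)) // conic_scale = (\<lambda>w. conic_scale `` {D w}) ` W"
  proof (intro subset_antisym subsetI)
    fix Q assume "Q \<in> (conic_scale `` (D ` W)) // conic_scale"
    then obtain w C where "w \<in> W" "(D w, C) \<in> conic_scale" "Q = conic_scale `` {C}"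
      by (auto elim!: quotientE)
    then show "Q \<in> (\<lambda>w. conic_scale `` {D w}) ` W"
      using cls by blast
  next
    fix Q assume "Q \<in> (\<lambda>w. conic_scale `` {D w}) ` W"
    then obtain w where "w \<in> W" "Q = conic_scale `` {D w}" by blast
    then show "Q \<in> (conic_scale `` (D ` W)) // conic_scale"
      using refl by (auto intro!: quotientI)
  qed
  moreover have "inj_on (\<lambda>w. conic_scale `` {D w}) W"
  proof (rule inj_onI)
    fix w w' assume h: "w \<in> W" "w' \<in> W" "conic_scale `` {D w} = conic_scale `` {D w'}"
    then have "(D w, D w') \<in> conic_scale"
      using refl by blast
    then show "w = w'" using assms(2) h by simp
  qed
  ultimately show ?thesis
    by (simp add: card_image)
qed

lemma card_square_roots:
  fixes z :: complex
  shows "card {w. w^2 = z} = (if z = 0 then 1 else 2)"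
proof -
  have "w^2 = z \<longleftrightarrow> w = csqrt z \<or> w = - csqrt z" for w
    by (metis power2_csqrt power2_eq_iff)
  then have "{w. w^2 = z} = {csqrt z, - csqrt z}"
    by auto
  then show ?thesis by (simp add: equation_minus_iff card_insert_if)
qed

section \<open>From general position to triangle coordinates\<close>

lemma cross_dot_cross:
  fixes u v w z :: "real^3"
  shows "(u \<times> v) \<bullet> (w \<times> z) = (u \<bullet> w) * (v \<bullet> z) - (u \<bullet> z) * (v \<bullet> w)"
  by (simp add: cross3_def inner_vec_def sum_3 algebra_simps)

text \<open>
  Both \<open>u \<times> v\<close> and the line that witnesses collinearity are orthogonal to \<open>u\<close> and \<open>v\<close>, hence
  parallel. So \<open>(u \<times> v) \<bullet> (l \<times> l')\<close> vanishes, and this number is the difference of the two sides.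
\<close>
lemma collinear_intersection_imp_proportional:
  assumes "proj_collinear {u, v, l \<times> l'}"
  shows "(u \<bullet> l) * (v \<bullet> l') = (u \<bullet> l') * (v \<bullet> l)"
proof -
  obtain m where m: "m \<noteq> 0" "u \<bullet> m = 0" "v \<bullet> m = 0" "(l \<times> l') \<bullet> m = 0"
    using assms by (auto simp: proj_collinear_def lies_on_def)
  have "m \<times> (u \<times> v) = 0"
    using m by (simp add: Lagrange inner_commute)
  then obtain c where "u \<times> v = c *\<^sub>R m"
    using m(1) by (metis cross_eq_0 collinear_lemma scaleR_zero_left)
  then have "(u \<times> v) \<bullet> (l \<times> l') = 0"
    using m(4) by (simp add: inner_commute)
  then show ?thesis by (simp add: cross_dot_cross)
qed

text \<open>
  The change of coordinates. The rows of \<open>X\<close> are the three points, in an order \<open>\<pi>\<close> that puts the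
  two points collinear with the intersection of the lines first; \<open>X *v l\<close> then holds the
  coordinates of a line \<open>l\<close>. The congruence \<open>C \<mapsto> X C X\<^sup>T\<close> carries solutions to triangle conics
  tangent to two lines, and \<open>Y = inverse X\<close> carries them back.
\<close>
lemma solutions_eq_pencil:
  fixes x :: "3 \<Rightarrow> real^3" and X Y :: "complex^3^3"
  assumes XY: "X ** Y = mat 1"
    and rows: "\<And>m. X $ m = complex_vec (x (\<pi> m))" and perm: "surj \<pi>"
    and l1: "X *v complex_vec l1 = vector [p, q, r]"
    and l2: "X *v complex_vec l2 = vector [t * p, t * q, t * s]"
    and nz: "p \<noteq> 0" "q \<noteq> 0" "t \<noteq> 0" "r \<noteq> s"
  defines "D \<equiv> \<lambda>w. Y ** pencil_conic p q r s w ** Finite_Cartesian_Product.transpose Y"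
  shows "solutions x l1 l2 = conic_scale `` (D ` {w. w^2 = r * s})"
    and "\<And>w. w^2 = r * s \<Longrightarrow> is_conic (D w)"
    and "\<And>w w'. (D w, D w') \<in> conic_scale \<Longrightarrow> w = w'"
proof -
  let ?T = "Finite_Cartesian_Product.transpose :: complex^3^3 \<Rightarrow> complex^3^3"
  have YX: "Y ** X = mat 1"
    using XY matrix_left_right_inverse by blast
  have TXY: "?T X ** ?T Y = mat 1" and TYX: "?T Y ** ?T X = mat 1"
    by (metis XY YX matrix_transpose_mul transpose_mat)+
  have detX: "det X \<noteq> 0"
    using XY YX by (auto simp: invertible_def simp flip: invertible_det_nz)
  have pull_back: "Y ** (X ** C ** ?T X) ** ?T Y = C" for C
  proof -
    have "Y ** (X ** C ** ?T X) ** ?T Y = (Y ** X) ** C ** (?T X ** ?T Y)"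
      by (simp add: matrix_mul_assoc)
    then show ?thesis by (simp add: YX TXY)
  qed
  have push_forward: "X ** (Y ** M ** ?T Y) ** ?T X = M" for M
  proof -
    have "X ** (Y ** M ** ?T Y) ** ?T X = (X ** Y) ** M ** (?T Y ** ?T X)"
      by (simp add: matrix_mul_assoc)
    then show ?thesis by (simp add: XY TYX)
  qed
  have congr_T: "?T (A ** C ** ?T A) = A ** ?T C ** ?T A" for A C
    by (simp add: matrix_transpose_mul matrix_mul_assoc)
  have symm: "?T (X ** C ** ?T X) = X ** C ** ?T X \<longleftrightarrow> ?T C = C" for C
    by (metis congr_T pull_back)
  have inv: "qform (matrix_inv C) v = qform (matrix_inv (X ** C ** ?T X)) (X *v v)"
    if "det C \<noteq> 0" for C v
    using qform_congruence[of "?T X" "matrix_inv (X ** C ** ?T X)" v]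
    by (simp add: matrix_inv_congruence[OF detX that])
  have det: "det (X ** C ** ?T X) \<noteq> 0 \<longleftrightarrow> det C \<noteq> 0" for C
    using detX by (simp add: det_mul det_transpose)
  have pts: "(\<forall>m. (X ** C ** ?T X)$m$m = 0) \<longleftrightarrow> (\<forall>m. qform C (complex_vec (x m)) = 0)" for C
    unfolding congruence_diagonal rows using perm by (metis surj_def)
  have det0: "C \<noteq> 0" if "det C \<noteq> 0" for C :: "complex^3^3"
    using that by (auto simp: det_3)
  have sol: "C \<in> solutions x l1 l2 \<longleftrightarrow>
      (\<exists>u w. u \<noteq> 0 \<and> w^2 = r * s \<and> C = map_matrix ((*) u) (D w))" for C
  proof -
    have "C \<in> solutions x l1 l2 \<longleftrightarrow>
        (\<exists>u w. u \<noteq> 0 \<and> w^2 = r * s \<and> X ** C ** ?T X = map_matrix ((*) u) (pencil_conic p q r s w))"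
      unfolding tangent_triangle_conics[OF nz, symmetric]
      unfolding symm det pts solutions_def nondegenerate_conic_def is_conic_def
      using det0 inv[of C] l1 l2 by auto
    also have "\<dots> \<longleftrightarrow> (\<exists>u w. u \<noteq> 0 \<and> w^2 = r * s \<and> C = map_matrix ((*) u) (D w))"
      unfolding D_def map_matrix_times_congruence[symmetric] by (metis pull_back push_forward)
    finally show ?thesis .
  qed
  have conic_sol: "is_conic C" if "C \<in> solutions x l1 l2" for C
    using that by (simp add: solutions_def nondegenerate_conic_def)
  show con: "is_conic (D w)" if "w^2 = r * s" for w
  proof -
    have "D w = map_matrix ((*) 1) (D w)"
      by (simp add: vec_eq_iff)
    then have "D w \<in> solutions x l1 l2"
      using sol that zero_neq_one by metis
    then show ?thesis
      by (rule conic_sol)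
  qed
  show "solutions x l1 l2 = conic_scale `` (D ` {w. w^2 = r * s})"
  proof (intro subset_antisym subsetI)
    fix C assume C: "C \<in> solutions x l1 l2"
    then obtain u w where "u \<noteq> 0" "w^2 = r * s" "C = map_matrix ((*) u) (D w)"
      using sol by blast
    then have "(D w, C) \<in> conic_scale"
      using con conic_sol[OF C] by (auto simp: conic_scale_def)
    then show "C \<in> conic_scale `` (D ` {w. w^2 = r * s})"
      using \<open>w^2 = r * s\<close> by blast
  next
    fix C assume "C \<in> conic_scale `` (D ` {w. w^2 = r * s})"
    then show "C \<in> solutions x l1 l2"
      unfolding sol by (auto simp: conic_scale_def)
  qed
  show "w = w'" if same: "(D w, D w') \<in> conic_scale" for w w'
  proof -
    obtain u where "D w' = map_matrix ((*) u) (D w)"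
      using same by (auto simp: conic_scale_def)
    then have "pencil_conic p q r s w' = map_matrix ((*) u) (pencil_conic p q r s w)"
      unfolding D_def by (metis push_forward map_matrix_times_congruence)
    then have "triangle_conic 1 (((r + s) / 2 - w') / (2 * q)) (((r + s) / 2 + w') / (2 * p)) $ m $ n =
        triangle_conic u (u * (((r + s) / 2 - w) / (2 * q))) (u * (((r + s) / 2 + w) / (2 * p))) $ m $ n"
      for m n
      by (simp add: pencil_conic_def scale_triangle_conic)
    from this[of 1 2] this[of 1 3] show ?thesis
      using nz by (simp add: triangle_conic_def)
  qed
qed

theorem theorem6:
  fixes x :: "3 \<Rightarrow> real^3" and l1 l2 :: "real^3" and i j k :: 3
  assumes "\<forall>m. finite_point (x m)"
    and "l1 \<noteq> 0" and "l2 \<noteq> 0" and "\<not> proj_eq l1 l2"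
    and "general_position x l1 l2"
    and "distinct [i, j, k]"
    and "proj_collinear {x i, x j, cross3 l1 l2}"
  shows "(\<not> lies_on (x k) l1 \<and> \<not> lies_on (x k) l2 \<longrightarrow>
            card (solutions x l1 l2 // conic_scale) = 2) \<and>
         (lies_on (x k) l1 \<or> lies_on (x k) l2 \<longrightarrow>
            card ({C \<in> solutions x l1 l2. real_conic C} // conic_scale) = 1)"
proof -
  \<comment> \<open>\<open>\<pi>\<close> lists the points in the order in which the hypotheses name them.\<close>
  define \<pi> :: "3 \<Rightarrow> 3" where "\<pi> m = (if m = 1 then i else if m = 2 then j else k)" for m
  have pi: "\<pi> 1 = i" "\<pi> 2 = j" "\<pi> 3 = k"
    by (simp_all add: \<pi>_def)
  have "inj \<pi>"
    using assms(6) by (auto simp: inj_def forall_3 pi)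
  then have surj: "surj \<pi>"
    by (simp add: finite_UNIV_inj_surj)
  have ker: "v = 0" if "x i \<bullet> v = 0" "x j \<bullet> v = 0" "x k \<bullet> v = 0" for v
  proof -
    have "x (\<pi> m) \<bullet> v = 0" for m
      using that exhaust_3[of m] by (auto simp: pi)
    then have "x m \<bullet> v = 0" for m
      using surj by (metis surj_def)
    then show "v = 0"
      using assms(5) by (auto simp: general_position_def proj_collinear_def lies_on_def)
  qed

  define X :: "real^3^3" where "X = (\<chi> m. x (\<pi> m))"
  have Xv: "X *v v = vector [x i \<bullet> v, x j \<bullet> v, x k \<bullet> v]" for v
    by (simp add: X_def vec_eq_iff forall_3 matrix_vector_mult_def inner_vec_def pi)
  have "v = 0" if "X *v v = 0" for v
    using that ker by (simp add: Xv vec_eq_iff forall_3)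
  then obtain Y where "Y ** X = mat 1"
    by (metis matrix_left_invertible_ker)
  then have XY: "X ** Y = mat 1"
    using matrix_left_right_inverse by blast

  define p q r where "p = x i \<bullet> l1" and "q = x j \<bullet> l1" and "r = x k \<bullet> l1"
  define p' q' r' where "p' = x i \<bullet> l2" and "q' = x j \<bullet> l2" and "r' = x k \<bullet> l2"
  note coords = p_def q_def r_def p'_def q'_def r'_def
  have ratio: "p * q' = p' * q"
    using collinear_intersection_imp_proportional[OF assms(7)] by (simp add: coords)
  have side1: "\<not> (p = 0 \<and> q = 0)" and side2: "\<not> (p' = 0 \<and> q' = 0)"
    using assms(5,6) by (auto simp: general_position_def triangle_side_def lies_on_def coords)
  have vertex: "\<not> (x m \<bullet> l1 = 0 \<and> x m \<bullet> l2 = 0)" for m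
  proof
    assume h: "x m \<bullet> l1 = 0 \<and> x m \<bullet> l2 = 0"
    then have "x m \<times> (l1 \<times> l2) = 0"
      by (simp add: Lagrange)
    moreover have "l1 \<times> l2 \<noteq> 0"
    proof
      assume "l1 \<times> l2 = 0"
      then obtain c where "l2 = c *\<^sub>R l1"
        using assms(2,3) by (metis cross_eq_0 collinear_lemma)
      then show False
        using assms(3,4) by (auto simp: proj_eq_def)
    qed
    moreover have "x m \<noteq> 0"
      using assms(1) by (metis finite_point_def zero_index zero_neq_one)
    ultimately obtain c where c: "x m = c *\<^sub>R (l1 \<times> l2)"
      by (metis cross_eq_0 collinear_lemma cross_skew neg_0_equal_iff_equal scaleR_zero_left)
    then have "proj_eq (l1 \<times> l2) (x m)"
      using \<open>x m \<noteq> 0\<close> by (auto simp: proj_eq_def)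
    then show False
      using assms(5) by (simp add: general_position_def)
  qed
  \<comment> \<open>If \<open>p = 0\<close>, then \<open>q \<noteq> 0\<close> because \<open>l1\<close> is not a side, so \<open>p' = 0\<close> by proportionality, and
    both lines pass through \<open>x i\<close>. The other three cases are alike.\<close>
  have nz: "p \<noteq> 0" "q \<noteq> 0" "p' \<noteq> 0" "q' \<noteq> 0"
    using ratio side1 side2 vertex[of i] vertex[of j] by (auto simp: coords)

  \<comment> \<open>Rescaling \<open>l2\<close> by \<open>1 / t\<close> makes it agree with \<open>l1\<close> in the first two coordinates; \<open>s\<close> is
    then its third coordinate.\<close>
  define t s where "t = p' / p" and "s = r' / t"
  have t: "t \<noteq> 0" "p' = t * p" "q' = t * q" "r' = t * s"
    using nz ratio by (auto simp: t_def s_def field_simps)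
  \<comment> \<open>Otherwise \<open>l2\<close> and \<open>t l1\<close> would have equal coordinates and the lines would coincide.\<close>
  have "r \<noteq> s"
  proof
    assume "r = s"
    then have "l2 - t *\<^sub>R l1 = 0"
      using t by (intro ker) (simp_all add: inner_diff_right coords)
    then show False
      using assms(4) t(1) by (auto simp: proj_eq_def)
  qed

  define CX CY where "CX = map_matrix complex_of_real X" and "CY = map_matrix complex_of_real Y"
  have "CX ** CY = map_matrix complex_of_real (mat 1)"
    by (simp add: CX_def CY_def XY flip: map_matrix_of_real_mult)
  then have CXY: "CX ** CY = mat 1"
    by (simp add: vec_eq_iff mat_def)
  have rows: "CX $ m = complex_vec (x (\<pi> m))" for m
    by (simp add: vec_eq_iff CX_def X_def complex_vec_def)
  have CXv: "CX *v complex_vec v = vector [of_real (x i \<bullet> v), of_real (x j \<bullet> v), of_real (x k \<bullet> v)]" for v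
    by (simp add: CX_def X_def vec_eq_iff forall_3 matrix_vector_mult_def inner_vec_def pi complex_vec_def)
  define D where "D w = CY ** pencil_conic p q r s w ** Finite_Cartesian_Product.transpose CY" for w
  define W where "W = {w :: complex. w^2 = of_real r * of_real s}"
  have l1: "CX *v complex_vec l1 = vector [of_real p, of_real q, of_real r]"
    by (simp add: CXv coords)
  have l2: "CX *v complex_vec l2 =
      vector [of_real t * of_real p, of_real t * of_real q, of_real t * of_real s]"
    unfolding CXv using t by (simp add: coords flip: of_real_mult)
  have nzc: "complex_of_real p \<noteq> 0" "complex_of_real q \<noteq> 0" "complex_of_real t \<noteq> 0"
      "complex_of_real r \<noteq> of_real s"
    using nz t \<open>r \<noteq> s\<close> by simp_all
  note sol = solutions_eq_pencil[OF CXY rows surj l1 l2 nzc, folded D_def W_def]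
  have S: "solutions x l1 l2 = conic_scale `` (D ` W)"
    using sol(1) by (simp add: D_def[abs_def] W_def)
  have con: "is_conic (D w)" if "w \<in> W" for w
    using sol(2) that by (simp add: W_def)
  have card: "card (solutions x l1 l2 // conic_scale) = (if r * s = 0 then 1 else 2)"
  proof -
    have "card (solutions x l1 l2 // conic_scale) = card W"
      unfolding S by (rule card_quotient_conic_scale) (use con sol(3) in auto)
    then show ?thesis
      by (simp add: W_def card_square_roots)
  qed
  have on1: "lies_on (x k) l1 \<longleftrightarrow> r = 0" and on2: "lies_on (x k) l2 \<longleftrightarrow> s = 0"
    using t by (auto simp: lies_on_def coords)
  \<comment> \<open>If \<open>r s = 0\<close> then \<open>w = 0\<close> is the only square root, and \<open>D 0\<close> has real entries.\<close>
  have real: "real_conic C" if "r * s = 0" "C \<in> solutions x l1 l2" for C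
  proof -
    have "W = {0}"
      using that(1) by (auto simp: W_def)
    then have DC: "(D 0, C) \<in> conic_scale"
      using that(2) by (auto simp: S)
    define R where "R = Y ** vector [vector [0, 1, (r + s) / 2 / (2 * q)], vector [1, 0, (r + s) / 2 / (2 * p)],
        vector [(r + s) / 2 / (2 * q), (r + s) / 2 / (2 * p), 0]] ** Finite_Cartesian_Product.transpose Y"
    have "map_matrix complex_of_real (vector [vector [0, 1, (r + s) / 2 / (2 * q)],
        vector [1, 0, (r + s) / 2 / (2 * p)],
        vector [(r + s) / 2 / (2 * q), (r + s) / 2 / (2 * p), 0]]) = pencil_conic p q r s 0"
      by (simp add: pencil_conic_def triangle_conic_def vec_eq_iff forall_3)
    moreover have "map_matrix complex_of_real (Finite_Cartesian_Product.transpose Y) =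
        Finite_Cartesian_Product.transpose CY"
      by (simp add: CY_def vec_eq_iff Finite_Cartesian_Product.transpose_def)
    ultimately have "map_matrix complex_of_real R = D 0"
      by (simp add: R_def map_matrix_of_real_mult D_def CY_def)
    moreover have "(C, D 0) \<in> conic_scale"
      using DC equiv_conic_scale by (meson equivE symD)
    ultimately show ?thesis
      unfolding real_conic_def by metis
  qed
  have "{C \<in> solutions x l1 l2. real_conic C} = solutions x l1 l2" if "r * s = 0"
    using real[OF that] by blast
  then show ?thesis
    using card by (auto simp: on1 on2)
qed

end
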